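(* Let $Q$ be a prime power, let $\alpha\in\mathbb{F}_{Q^2}^*$ and let $\beta\in\mathbb{F}_Q$. The polynomial $f(x):=\alpha x^{Q+2}+\beta x$ is a complete permutation polynomial over $\mathbb{F}_{Q^2}$ if and only if one of the following holds: (1) $Q\equiv 5\pmod{6}$ and $\alpha^{Q-1}$ has order $6$; (2) $Q\equiv 2\pmod{6}$ and $\alpha^{Q-1}$ has order $3$; or (3) $Q\equiv 0\pmod{3}$ and $\alpha^{Q-1}=-1$.
   Context: For a prime power $Q$, $\mathbb{F}_Q$ denotes the finite field with $Q$ elements, regarded as a subfield of $\mathbb{F}_{Q^2}$; orders of elements are taken in the multiplicative group $\mathbb{F}_{Q^2}^*$ of nonzero elements. A polynomial is a permutation polynomial over a finite field $\mathbb{F}$ if it induces a bijection from $\mathbb{F}$ to itself. A complete permutation polynomial over $\mathbb{F}_q$ is a polynomial $f(x)\in\mathbb{F}_q[x]$ such that both $f(x)$ and $f(x)+x$ are permutation polynomials over $\mathbb{F}_q$. *)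

theory Defs
  imports
    "HOL-Library.Cardinality"
    "HOL-Number_Theory.Prime_Powers"
    "HOL-Number_Theory.Cong"
    "HOL-Algebra.Subrings"
    "HOL-Algebra.Multiplicative_Group"
    "HOL-Algebra.Algebraic_Closure_Type"
    "HOL-Computational_Algebra.Polynomial"
begin

definition permutation_polynomial :: "'a::{finite,field} poly \<Rightarrow> bool" where
  "permutation_polynomial f \<longleftrightarrow> bij (poly f)"

definition complete_permutation_polynomial :: "'a::{finite,field} poly \<Rightarrow> bool" where
  "complete_permutation_polynomial f \<longleftrightarrow>
     permutation_polynomial f \<and> permutation_polynomial (f + [:0, 1:])"

text \<open>The constant \<open>ring_of_type_algebra\<close> is the HOL-Algebra ring with carrier \<open>UNIV\<close> built
  from the operations of the type class. Since \<open>mult_of\<close> removes zero from the carrier,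
  \<open>mult_order\<close> is meaningful for nonzero arguments only.\<close>

definition mult_order :: "'a::field \<Rightarrow> nat" where
  "mult_order a = group.ord (Multiplicative_Group.mult_of (ring_of_type_algebra :: 'a ring)) a"

definition is_subfield :: "'a::field set \<Rightarrow> bool" where
  "is_subfield K \<longleftrightarrow> subfield K (ring_of_type_algebra :: 'a ring)"

end

theory Submission
  imports Defs "HOL-Number_Theory.Residues"
begin

text \<open>
  After division by \<open>\<alpha>\<close> the question is when \<open>g(x) = x^(Q+2) + dx = x(N(x) + d)\<close> is injective,
  where \<open>N(x) = x^(Q+1)\<close> is the norm to the subfield \<open>K\<close> of order \<open>Q\<close> and \<open>d\<close> is \<open>\<beta>/\<alpha>\<close> or
  \<open>(\<beta>+1)/\<alpha>\<close>. Taking norms, \<open>N(g(x)) = h(N(x))\<close> for the cubic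
  \<open>h(n) = n(n + d)(n + d^Q) = n^3 + Tn^2 + Mn\<close> over \<open>K\<close>, so \<open>g\<close> is injective iff \<open>h\<close> is injective on
  \<open>K\<close> and \<open>-d\<close> is not a nonzero norm. A cubic can be injective on \<open>K\<close> only if \<open>T^2 = 3M\<close>; away from
  characteristic 3 it is then a shifted cube. With \<open>z = \<alpha>^(Q-1)\<close>, for nonzero \<open>d\<close> the condition
  \<open>T^2 = 3M\<close> reads \<open>z^2 - z + 1 = 0\<close>, which is the three cases of the theorem at once. At least one
  of \<open>\<beta>\<close> and \<open>\<beta> + 1\<close> is nonzero.
\<close>

section \<open>Counting in finite fields and orders of elements\<close>

text \<open>Multiplication by a nonzero \<open>x\<close> permutes the nonzero elements of
  \<open>S\<close>. Comparing the products before and after, and cancelling, gives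
  \<open>x ^ (card S - 1) = 1\<close>.\<close>

lemma power_card_eq_self:
  fixes S :: "'a::field set"
  assumes "finite S" "0 \<in> S" "\<And>x y. x \<in> S \<Longrightarrow> y \<in> S \<Longrightarrow> x * y \<in> S" "x \<in> S"
  shows "x ^ card S = x"
proof (cases "x = 0")
  case True
  with assms(1,2) show ?thesis by (auto simp: card_gt_0_iff)
next
  case False
  let ?T = "S - {0}"
  have inj: "inj_on ((*) x) ?T" using False by (auto simp: inj_on_def)
  have "(*) x ` ?T = ?T"
    by (rule endo_inj_surj) (use assms False inj in auto)
  then have "\<Prod>?T = prod ((*) x) ?T"
    using prod.reindex[OF inj, of "\<lambda>y. y"] by simp
  also have "\<dots> = x ^ card ?T * \<Prod>?T" by (simp add: prod.distrib)
  finally have "x ^ card ?T = 1" using assms(1) by simp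
  moreover have "card S = Suc (card ?T)"
    using assms(1,2) by (rule card.remove)
  ultimately show ?thesis by simp
qed

lemma card_le_mult_card_image:
  assumes "finite A" "\<And>y. y \<in> f ` A \<Longrightarrow> card {x \<in> A. f x = y} \<le> k"
  shows "card A \<le> k * card (f ` A)"
proof -
  have "A = (\<Union>y\<in>f ` A. {x \<in> A. f x = y})" by auto
  then have "card A \<le> (\<Sum>y\<in>f ` A. card {x \<in> A. f x = y})"
    using card_UN_le[of "f ` A" "\<lambda>y. {x \<in> A. f x = y}"] assms(1) by simp
  also have "\<dots> \<le> of_nat (card (f ` A)) * k"
    by (rule sum_bounded_above) (rule assms(2))
  finally show ?thesis by (simp add: mult.commute)
qed

lemma card_nth_roots_le:
  fixes c :: "'a::field"
  assumes "n > 0"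
  shows "finite {x. x ^ n = c}" "card {x. x ^ n = c} \<le> n"
proof -
  let ?p = "Polynomial.monom 1 n - [:c:]"
  have deg: "degree ?p = n"
    using assms degree_add_eq_left[of "- [:c:]" "Polynomial.monom 1 n"]
    by (simp add: degree_monom_eq del: minus_pCons)
  then have "?p \<noteq> 0" using assms by auto
  moreover have "{x. x ^ n = c} = {x. poly ?p x = 0}"
    by (auto simp: poly_monom)
  ultimately show "finite {x. x ^ n = c}" "card {x. x ^ n = c} \<le> n"
    using poly_roots_finite[of ?p] card_poly_roots_bound[of ?p] deg by auto
qed

lemma card_power_fixed_le:
  assumes "n > 1"
  shows "card {x::'a::field. x ^ n = x} \<le> n"
proof -
  let ?p = "Polynomial.monom (1::'a) n - [:0, 1:]"
  have deg: "degree ?p = n"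
    using assms degree_add_eq_left[of "- [:0, 1::'a:]" "Polynomial.monom 1 n"]
    by (simp add: degree_monom_eq del: minus_pCons)
  then have "?p \<noteq> 0" using assms by auto
  moreover have "{x. x ^ n = x} = {x. poly ?p x = 0}"
    by (auto simp: poly_monom)
  ultimately show ?thesis
    using card_poly_roots_bound[of ?p] deg by auto
qed

text \<open>Squaring is at most two-to-one on the nonzero elements, and \<open>0\<close> contributes
  one more square. The extra \<open>1\<close> makes the squares more than half of \<open>K\<close>,
  as the pigeonhole argument for cubics requires.\<close>

lemma card_le_twice_card_squares:
  fixes K :: "'a::field set"
  assumes "finite K" "0 \<in> K"
  shows "card K + 1 \<le> 2 * card ((\<lambda>x. x\<^sup>2) ` K)"
proof -
  let ?sq = "\<lambda>x::'a. x\<^sup>2"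
  have "card (K - {0}) \<le> 2 * card (?sq ` (K - {0}))"
  proof (rule card_le_mult_card_image)
    fix y
    have "card {x \<in> K - {0}. x\<^sup>2 = y} \<le> card {x. x\<^sup>2 = y}"
      by (rule card_mono) (auto simp: card_nth_roots_le)
    then show "card {x \<in> K - {0}. x\<^sup>2 = y} \<le> 2"
      using card_nth_roots_le(2)[of 2 y] by linarith
  qed (use assms in auto)
  moreover have "?sq ` (K - {0}) = ?sq ` K - {0}" by auto
  moreover have "card K = Suc (card (K - {0}))"
    using assms by (rule card.remove)
  moreover have "card (?sq ` K) = Suc (card (?sq ` K - {0}))"
    by (rule card.remove) (use assms in \<open>auto intro!: image_eqI[of _ _ 0]\<close>)
  ultimately show ?thesis by simp
qed

text \<open>Powers in the HOL-Algebra group agree with type class powers, so the divisibility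
  criterion for orders carries over.\<close>

lemma mult_order_dvd_iff:
  fixes a :: "'a::field"
  assumes "a \<noteq> 0"
  shows "a ^ n = 1 \<longleftrightarrow> mult_order a dvd n"
proof -
  let ?R = "ring_of_type_algebra :: 'a ring"
  interpret group "Multiplicative_Group.mult_of ?R"
    by (rule field.field_mult_group) (rule field_from_type_algebra)
  have "a [^]\<^bsub>Multiplicative_Group.mult_of ?R\<^esub> k = a ^ k" for k :: nat
    by (induction k) (simp_all add: ring_of_type_algebra_def nat_pow_mult_of mult.commute)
  moreover have "a \<in> carrier (Multiplicative_Group.mult_of ?R)"
    using assms by (simp add: ring_of_type_algebra_def)
  ultimately show ?thesis
    using pow_eq_id[of a n] by (simp add: mult_order_def ring_of_type_algebra_def)
qed

section \<open>Cubics that are injective on a finite subfield\<close>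

locale finite_subfield =
  fixes K :: "'a::{finite,field} set"
  assumes zero_mem [simp]: "0 \<in> K"
    and one_mem [simp]: "1 \<in> K"
    and add_mem [simp]: "x \<in> K \<Longrightarrow> y \<in> K \<Longrightarrow> x + y \<in> K"
    and mult_mem [simp]: "x \<in> K \<Longrightarrow> y \<in> K \<Longrightarrow> x * y \<in> K"
    and uminus_mem [simp]: "x \<in> K \<Longrightarrow> - x \<in> K"
    and inverse_mem [simp]: "x \<in> K \<Longrightarrow> inverse x \<in> K"
begin

lemma diff_mem [simp]: "x \<in> K \<Longrightarrow> y \<in> K \<Longrightarrow> x - y \<in> K"
  using add_mem[of x "- y"] by simp

lemma divide_mem [simp]: "x \<in> K \<Longrightarrow> y \<in> K \<Longrightarrow> x / y \<in> K"
  by (simp add: divide_inverse)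

lemma power_mem [simp]: "x \<in> K \<Longrightarrow> x ^ n \<in> K"
  by (induction n) auto

lemma numeral_mem [simp]: "numeral n \<in> K"
  by (induction n) (simp_all only: numeral.simps one_mem add_mem)

lemma inj_on_squares_char_2:
  assumes "(2::'a) = 0"
  shows "inj_on (\<lambda>x. x\<^sup>2) K"
proof (rule inj_onI)
  fix x y :: 'a assume "x\<^sup>2 = y\<^sup>2"
  moreover have "(x - y)\<^sup>2 = x\<^sup>2 - y\<^sup>2 - 2 * y * (x - y)"
    by (simp add: power2_eq_square algebra_simps)
  ultimately show "x = y" using assms by simp
qed

text \<open>In characteristic 2 every element of \<open>K\<close> is a square, so there is a nonzero
  root. Otherwise a collision of distinct \<open>x\<close> and \<open>y\<close> means
  \<open>x\<^sup>2 + x * y + y\<^sup>2 + a = 0\<close>, which in terms of \<open>s = x + y\<close>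
  and \<open>d = x - y\<close> reads \<open>3 * s\<^sup>2 + d\<^sup>2 = - 4 * a\<close>.\<close>

lemma depressed_cubic_not_inj:
  assumes a: "a \<in> K" "a \<noteq> 0" and char3: "(3::'a) \<noteq> 0"
  shows "\<not> inj_on (\<lambda>x. x ^ 3 + a * x) K"
proof (cases "(2::'a) = 0")
  case True
  have "(\<lambda>x. x\<^sup>2) ` K = K"
    by (rule endo_inj_surj) (use True inj_on_squares_char_2 in auto)
  with a obtain x where x: "x \<in> K" "- a = x\<^sup>2" by (metis imageE uminus_mem)
  then have "x ^ 3 + a * x = 0 ^ 3 + a * 0"
    by (simp add: power3_eq_cube power2_eq_square add_eq_0_iff2 flip: mult_minus_left)
  moreover have "x \<noteq> 0" using a x by auto
  ultimately show ?thesis using x zero_mem unfolding inj_on_def by blast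
next
  case False
  let ?S = "(\<lambda>x. x\<^sup>2) ` K"
  \<comment> \<open>Each of \<open>?A\<close> and \<open>?B\<close> fills more than half of
    \<open>K\<close>, so they meet; a common element solves the equation in \<open>s\<close> and
    \<open>d\<close>.\<close>
  let ?A = "(\<lambda>x. 3 * x) ` ?S" and ?B = "(\<lambda>x. - 4 * a - x) ` ?S"
  have four: "(4::'a) \<noteq> 0"
    using False by (metis mult_2 mult_eq_0_iff numeral_Bit0)
  have "card ?A = card ?S" "card ?B = card ?S"
    by (intro card_image inj_onI; use char3 in simp)+
  then have "card ?A + card ?B > card K"
    using card_le_twice_card_squares[of K] by simp
  moreover have "card (?A \<union> ?B) \<le> card K"
    by (rule card_mono) (use a in auto)
  ultimately have "?A \<inter> ?B \<noteq> {}"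
    by (metis card_Un_disjoint finite leD)
  then obtain s d where sd: "s \<in> K" "d \<in> K" "3 * s\<^sup>2 = - 4 * a - d\<^sup>2" by auto
  \<comment> \<open>The equation above says that (s + d)/2 and (s - d)/2 have the same image;
    for d = 0 it says that r = s/2 is a critical point, and then -2r has the same image as r.\<close>
  show ?thesis
  proof (cases "d = 0")
    case True
    define r where "r = s / 2"
    have s: "s = 2 * r" using False by (simp add: r_def)
    have "4 * a = 4 * (- 3 * r\<^sup>2)"
      using sd True by (simp add: s power2_eq_square algebra_simps)
    then have a_eq: "a = - 3 * r\<^sup>2" using four by (simp only: mult_cancel_left) simp
    then have "r \<noteq> 0" using a by auto
    then have "r \<noteq> - 2 * r"
      using char3 by (auto simp: eq_neg_iff_add_eq_0 simp flip: distrib_right)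
    moreover have "r ^ 3 + a * r = (- 2 * r) ^ 3 + a * (- 2 * r)"
      unfolding a_eq by (simp add: power2_eq_square power3_eq_cube algebra_simps)
    moreover have "r \<in> K" "- 2 * r \<in> K" using sd by (auto simp: r_def)
    ultimately show ?thesis unfolding inj_on_def by blast
  next
    case d: False
    define x y where "x = (s + d) / 2" and "y = s - x"
    have "2 * x = s + d" using False by (simp add: x_def)
    then have xy: "x + y = s" "x - y = d"
      by (simp_all add: y_def mult_2 algebra_simps)
    have "4 * (x\<^sup>2 + x * y + y\<^sup>2 + a) = 3 * s\<^sup>2 + d\<^sup>2 + 4 * a"
      unfolding xy[symmetric] by (simp add: power2_eq_square algebra_simps)
    also have "\<dots> = 0" unfolding sd(3) by simp
    finally have "x\<^sup>2 + x * y + y\<^sup>2 + a = 0" using four mult_eq_0_iff by blast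
    moreover have "(x ^ 3 + a * x) - (y ^ 3 + a * y) = (x - y) * (x\<^sup>2 + x * y + y\<^sup>2 + a)"
      by (simp add: power2_eq_square power3_eq_cube algebra_simps)
    ultimately have "x ^ 3 + a * x = y ^ 3 + a * y" by simp
    moreover have "x \<in> K" "y \<in> K" using sd by (auto simp: x_def y_def)
    moreover have "x \<noteq> y" using d xy(2) by auto
    ultimately show ?thesis unfolding inj_on_def by blast
  qed
qed

text \<open>Up to the factor 4, \<open>T\<^sup>2 - 3 * M\<close> is the discriminant of the
  derivative of the cubic. Outside characteristic 3, a shift by \<open>T / 3\<close> removes the
  square term and leaves a linear coefficient \<open>a\<close> with
  \<open>3 * a = 3 * M - T\<^sup>2\<close>, so the depressed case applies.\<close>

lemma cubic_inj_imp_discriminant: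
  assumes "T \<in> K" "M \<in> K" and inj: "inj_on (\<lambda>x. x ^ 3 + T * x\<^sup>2 + M * x) K"
  shows "T\<^sup>2 = 3 * M"
proof (rule ccontr)
  assume neq: "T\<^sup>2 \<noteq> 3 * M"
  show False
  proof (cases "(3::'a) = 0")
    case True
    \<comment> \<open>In characteristic 3 the point M/T is critical, so the cubic minus its value
      there is a multiple of the square of x - M/T, with the third root M/T - T.\<close>
    with neq have T: "T \<noteq> 0" by auto
    define n where "n = M / T"
    have M: "M = T * n" using T by (simp add: n_def)
    have "(n - T) ^ 3 + T * (n - T)\<^sup>2 + M * (n - T) - (n ^ 3 + T * n\<^sup>2 + M * n)
      = 3 * (n * T\<^sup>2 - n\<^sup>2 * T - T\<^sup>2 * n)"
      unfolding M by (simp add: power2_eq_square power3_eq_cube algebra_simps)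
    then have "(n - T) ^ 3 + T * (n - T)\<^sup>2 + M * (n - T) = n ^ 3 + T * n\<^sup>2 + M * n"
      using True by simp
    moreover have "n \<in> K" "n - T \<in> K" using assms by (auto simp: n_def)
    ultimately have "n - T = n" using inj unfolding inj_on_def by blast
    then show False using T by simp
  next
    case False
    define t a where "t = T / 3" and "a = M - 3 * t\<^sup>2"
    have T: "T = 3 * t" using False by (simp add: t_def)
    have tK: "t \<in> K" "a \<in> K" using assms by (auto simp: t_def a_def)
    have "3 * a \<noteq> 0" using neq by (simp add: a_def T power2_eq_square algebra_simps)
    then have "\<not> inj_on (\<lambda>x. x ^ 3 + a * x) K"
      using depressed_cubic_not_inj tK False by auto
    then obtain x y where xy: "x \<in> K" "y \<in> K" "x \<noteq> y" "x ^ 3 + a * x = y ^ 3 + a * y"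
      unfolding inj_on_def by blast
    have "(z - t) ^ 3 + T * (z - t)\<^sup>2 + M * (z - t) = z ^ 3 + a * z + (2 * t ^ 3 - M * t)" for z
      unfolding T a_def by (simp add: power2_eq_square power3_eq_cube algebra_simps)
    then have "x - t = y - t"
      using inj_onD[OF inj, of "x - t" "y - t"] xy tK by simp
    with xy show False by simp
  qed
qed

end

section \<open>Frobenius map and norm of the quadratic extension\<close>

text \<open>Writing \<open>Q\<close> as a power of the characteristic makes \<open>x ^ Q\<close>
  additive, and describing \<open>K\<close> as its fixed points turns membership into an
  equation.\<close>

locale quadratic_extension =
  fixes K :: "'a::{finite,field} set" and Q e :: nat
  assumes Q_eq: "Q = CHAR('a) ^ e" and e_pos: "e > 0"
    and K_eq: "K = {x. x ^ Q = x}"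
    and card_UNIV: "CARD('a) = Q\<^sup>2" and card_K: "card K = Q"
begin

lemma prime_CHAR: "Factorial_Ring.prime CHAR('a)"
  by (rule prime_CHAR_semidom) (simp add: finite_imp_CHAR_pos)

lemma Q_gt_1: "Q > 1"
  unfolding Q_eq using prime_gt_1_nat[OF prime_CHAR] e_pos by (rule one_less_power)

lemma prime_dvd_Q_iff: "Factorial_Ring.prime p \<Longrightarrow> p dvd Q \<longleftrightarrow> (of_nat p :: 'a) = 0"
  unfolding Q_eq of_nat_eq_0_iff_char_dvd
  using e_pos prime_CHAR by (metis dvd_power prime_dvd_power primes_dvd_imp_eq dvd_refl)

lemma frobenius_add: "(x + y :: 'a) ^ Q = x ^ Q + y ^ Q"
  by (rule freshmans_dream'[OF prime_CHAR Q_eq])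

lemma frobenius_minus: "(- x :: 'a) ^ Q = - (x ^ Q)"
proof -
  have "x ^ Q + (- x) ^ Q = 0"
    using frobenius_add[of x "- x"] Q_gt_1 by (simp add: zero_power)
  then show ?thesis by (simp add: eq_neg_iff_add_eq_0 add.commute)
qed

sublocale finite_subfield K
  by standard
    (use Q_gt_1 in \<open>auto simp: K_eq frobenius_add frobenius_minus power_mult_distrib power_inverse\<close>)

lemma frobenius_mem: "x \<in> K \<Longrightarrow> x ^ Q = x"
  by (simp add: K_eq)

lemma frobenius_frobenius: "(x ^ Q) ^ Q = (x :: 'a)"
  using power_card_eq_self[of UNIV x] by (simp add: card_UNIV power2_eq_square power_mult)

lemma norm_mem: "x ^ (Q + 1) \<in> K"
  by (simp add: K_eq power_mult_distrib frobenius_frobenius)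

text \<open>The norm has fibres of size at most \<open>Q + 1\<close> on the
  \<open>(Q + 1) * (Q - 1)\<close> nonzero elements. It therefore takes at least
  \<open>Q - 1\<close> nonzero values, which is all that \<open>K\<close> has.\<close>

lemma norm_surj:
  assumes "y \<in> K"
  shows "\<exists>x. x ^ (Q + 1) = y"
proof (cases "y = 0")
  case False
  let ?N = "\<lambda>x::'a. x ^ (Q + 1)"
  let ?A = "UNIV - {0::'a}"
  have "card ?A \<le> (Q + 1) * card (?N ` ?A)"
  proof (rule card_le_mult_card_image)
    fix y
    have "card {x \<in> ?A. ?N x = y} \<le> card {x. ?N x = y}"
      by (rule card_mono) auto
    then show "card {x \<in> ?A. ?N x = y} \<le> Q + 1"
      using card_nth_roots_le(2)[of "Q + 1" y] by linarith
  qed auto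
  moreover have "card ?A = (Q + 1) * (Q - 1)"
    using Q_gt_1 by (simp add: card_Diff_singleton card_UNIV power2_eq_square algebra_simps)
  ultimately have "Q - 1 \<le> card (?N ` ?A)"
    by (simp only: mult_le_cancel1)
  moreover have "card (K - {0}) = Q - 1" by (simp add: card_K)
  moreover have "?N ` ?A \<subseteq> K - {0}" using norm_mem by auto
  ultimately have "?N ` ?A = K - {0}" by (intro card_seteq) auto
  moreover have "y \<in> K - {0}" using False assms by simp
  ultimately have "y \<in> ?N ` ?A" by (simp only:)
  then show ?thesis by (rule imageE) (rule exI, rule sym)
qed (auto intro: exI[of _ 0])

section \<open>Injectivity of the binomial through its norm\<close>

lemma binomial_factor: "(x::'a) ^ (Q + 2) + d * x = x * (x ^ (Q + 1) + d)"
  by (simp add: algebra_simps power2_eq_square)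

text \<open>The norm \<open>n\<close> of \<open>x\<close> is fixed by Frobenius, so the conjugate of
  \<open>n + d\<close> is \<open>n + d ^ Q\<close> and the result depends on \<open>x\<close> only
  through \<open>n\<close>.\<close>

lemma norm_binomial:
  "((x::'a) ^ (Q + 2) + d * x) ^ (Q + 1) =
    (x ^ (Q + 1)) ^ 3 + (d + d ^ Q) * (x ^ (Q + 1))\<^sup>2 + d * d ^ Q * x ^ (Q + 1)"
proof -
  define n where "n = x ^ (Q + 1)"
  have n: "n ^ Q = n" unfolding n_def by (rule frobenius_mem[OF norm_mem])
  have "(x * (n + d)) ^ (Q + 1) = n * ((n + d) ^ Q * (n + d))"
    by (simp only: power_mult_distrib n_def power_add power_one_right mult_ac)
  also have "\<dots> = n * ((n + d ^ Q) * (n + d))"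
    by (simp only: frobenius_add n)
  also have "\<dots> = n ^ 3 + (d + d ^ Q) * n\<^sup>2 + d * d ^ Q * n"
    by (simp add: algebra_simps power2_eq_square power3_eq_cube)
  finally show ?thesis unfolding binomial_factor n_def .
qed

lemma inj_binomial_iff:
  "inj (\<lambda>x::'a. x ^ (Q + 2) + d * x) \<longleftrightarrow>
    (d \<in> K \<longrightarrow> d = 0) \<and> inj_on (\<lambda>n. n ^ 3 + (d + d ^ Q) * n\<^sup>2 + d * d ^ Q * n) K"
  (is "inj ?g \<longleftrightarrow> _ \<and> inj_on ?h K")
proof (intro iffI conjI impI)
  assume inj: "inj ?g"
  { assume "d \<in> K"
    then obtain x where x: "x ^ (Q + 1) = - d" using norm_surj by (metis uminus_mem)
    then have "?g x = ?g 0" unfolding binomial_factor by simp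
    then have "x = 0" by (rule injD[OF inj])
    with x show "d = 0" by simp }
  show "inj_on ?h K"
  proof (rule inj_onI)
    fix m n assume "m \<in> K" "n \<in> K" and eq: "?h m = ?h n"
    then obtain x y where xy: "x ^ (Q + 1) = m" "y ^ (Q + 1) = n" using norm_surj by metis
    have norms: "?g x ^ (Q + 1) = ?g y ^ (Q + 1)"
      unfolding norm_binomial xy by (rule eq)
    show "m = n"
    proof (cases "?g x = 0")
      case True
      with norms have "?g y = 0" by auto
      with True have "?g x = ?g y" by simp
      then show ?thesis using injD[OF inj] xy by blast
    next
      case False
      \<comment> \<open>The quotient \<open>u\<close> has norm 1. Multiplying \<open>x\<close> by
        \<open>u\<close> keeps its norm, so \<open>?g\<close> commutes with this multiplication and
        a collision of \<open>?h\<close> lifts to one of \<open>?g\<close>.\<close>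
      define u where "u = ?g y / ?g x"
      have "?g x ^ (Q + 1) \<noteq> 0" using False by (rule power_not_zero)
      then have u: "u ^ (Q + 1) = 1"
        unfolding u_def power_divide norms[symmetric] by (rule divide_self)
      have "?g (u * x) = u * ?g x"
        unfolding binomial_factor power_mult_distrib[of u x "Q + 1"] u by simp
      also have "\<dots> = ?g y" using False by (simp add: u_def)
      finally have "u * x = y" by (rule injD[OF inj])
      then show ?thesis using xy u power_mult_distrib[of u x "Q + 1"] by simp
    qed
  qed
next
  assume *: "(d \<in> K \<longrightarrow> d = 0) \<and> inj_on ?h K"
  show "inj ?g"
  proof (rule injI)
    fix x y assume eq: "?g x = ?g y"
    define n where "n = x ^ (Q + 1)"
    have "?h n = ?h (y ^ (Q + 1))"
      unfolding n_def norm_binomial[symmetric] eq ..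
    then have ny: "n = y ^ (Q + 1)"
      using * norm_mem unfolding n_def inj_on_def by blast
    show "x = y"
    proof (cases "n = 0")
      case True
      then show ?thesis using ny by (auto simp: n_def)
    next
      case False
      \<comment> \<open>Equal norms give both sides the common factor \<open>n + d\<close>; if it
        vanished, \<open>d = - n\<close> would be a nonzero element of \<open>K\<close>.\<close>
      have "n + d \<noteq> 0"
      proof
        assume "n + d = 0"
        then have d: "d = - n" by (simp add: eq_neg_iff_add_eq_0 add.commute)
        then have "d \<in> K" using norm_mem by (simp only: n_def uminus_mem)
        with * d False show False by simp
      qed
      moreover have "x * (n + d) = y * (n + d)"
        using eq unfolding binomial_factor n_def[symmetric] ny[symmetric] .
      ultimately show ?thesis by simp
    qed
  qed
qed

text \<open>In characteristic 3 the discriminant condition forces \<open>d ^ Q = - d\<close>, and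
  the cubic becomes the additive map \<open>n ^ 3 - d\<^sup>2 * n\<close>, whose roots
  \<open>0\<close>, \<open>d\<close>, \<open>- d\<close> meet \<open>K\<close> only in
  \<open>0\<close>. Otherwise the cubic is a shifted cube, and cubing is injective on
  \<open>K\<close> because \<open>Q mod 3 = 2\<close>.\<close>

lemma inj_on_cubic:
  assumes "Q mod 3 \<noteq> 1" and d: "d \<in> K \<Longrightarrow> d = 0" and disc: "(d + d ^ Q)\<^sup>2 = 3 * (d * d ^ Q)"
  shows "inj_on (\<lambda>n. n ^ 3 + (d + d ^ Q) * n\<^sup>2 + d * d ^ Q * n) K"
proof (rule inj_onI)
  fix m n
  assume mn: "m \<in> K" "n \<in> K"
  define T M where "T = d + d ^ Q" and "M = d * d ^ Q"
  assume "m ^ 3 + (d + d ^ Q) * m\<^sup>2 + d * d ^ Q * m = n ^ 3 + (d + d ^ Q) * n\<^sup>2 + d * d ^ Q * n"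
  then have eq: "m ^ 3 + T * m\<^sup>2 + M * m = n ^ 3 + T * n\<^sup>2 + M * n"
    by (simp only: T_def M_def)
  have TM: "T\<^sup>2 = 3 * M" using disc by (simp add: T_def M_def)
  show "m = n"
  proof (cases "(3::'a) = 0")
    case True
    then have T0: "T = 0" using TM by simp
    then have dQ: "d ^ Q = - d" by (simp add: T_def eq_neg_iff_add_eq_0 add.commute)
    have M: "M = - d\<^sup>2" by (simp add: M_def dQ power2_eq_square)
    have eq': "m ^ 3 - d\<^sup>2 * m = n ^ 3 - d\<^sup>2 * n" using eq unfolding T0 M by simp
    \<comment> \<open>The left side is the additive map at \<open>m - n\<close>; the multiple of 3
      corrects for \<open>(m - n) ^ 3\<close> not being \<open>m ^ 3 - n ^ 3\<close> in
      general.\<close>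
    have "(m - n) * (m - n - d) * (d - (n - m)) =
        (m ^ 3 - d\<^sup>2 * m) - (n ^ 3 - d\<^sup>2 * n) - 3 * (m * n * (m - n))"
      by (simp add: algebra_simps power2_eq_square power3_eq_cube)
    also have "\<dots> = 0" unfolding eq' True by simp
    finally consider "m = n" | "m - n = d" | "d = n - m"
      unfolding mult_eq_0_iff right_minus_eq by blast
    then show ?thesis
    proof cases
      case 2
      then have "d \<in> K" using diff_mem[OF mn] by simp
      then have "d = 0" by (rule d)
      with 2 show ?thesis by simp
    next
      case 3
      then have "d \<in> K" using diff_mem[OF mn(2,1)] by simp
      then have "d = 0" by (rule d)
      with 3 show ?thesis by simp
    qed
  next
    case False
    then have "\<not> 3 dvd Q" using prime_dvd_Q_iff[of 3] by simp
    with assms(1) have "Q mod 3 = 2" by presburger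
    \<comment> \<open>The exponent \<open>2 * (Q div 3) + 1\<close> is
      \<open>(2 * Q - 1) / 3\<close>, an inverse of 3 modulo \<open>Q - 1\<close>, so raising to it
      undoes cubing on \<open>K\<close>.\<close>
    then have *: "3 * (2 * (Q div 3) + 1) = Q + (Q - 1)" by presburger
    have cube: "(x ^ 3) ^ (2 * (Q div 3) + 1) = x" if "x \<in> K" for x
    proof -
      have "(x ^ 3) ^ (2 * (Q div 3) + 1) = x ^ (Q + (Q - 1))"
        by (simp only: power_mult[symmetric] *)
      also have "\<dots> = x * x ^ (Q - 1)" by (simp add: power_add frobenius_mem that)
      also have "\<dots> = x ^ Q" using Q_gt_1 by (simp flip: power_Suc)
      finally show ?thesis using that frobenius_mem by simp
    qed
    have expand: "(3 * x + T) ^ 3 = 27 * (x ^ 3 + T * x\<^sup>2 + M * x) + T ^ 3" for x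
    proof -
      have "(3 * x + T) ^ 3 = 27 * x ^ 3 + 27 * T * x\<^sup>2 + 9 * T\<^sup>2 * x + T ^ 3"
        by (simp add: algebra_simps power2_eq_square power3_eq_cube)
      then show ?thesis unfolding TM by (simp add: algebra_simps)
    qed
    have "d + d ^ Q \<in> K"
      by (simp add: K_eq frobenius_add frobenius_frobenius add.commute)
    then have mem: "3 * m + T \<in> K" "3 * n + T \<in> K" using mn by (simp_all add: T_def)
    have "(3 * m + T) ^ 3 = (3 * n + T) ^ 3" unfolding expand eq ..
    then have "3 * m + T = 3 * n + T" using cube[OF mem(1)] cube[OF mem(2)] by argo
    then show ?thesis using False by simp
  qed
qed

section \<open>From the discriminant to a cyclotomic equation\<close>

lemma inj_scaled_binomial_iff:
  fixes \<alpha> \<gamma> :: 'a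
  assumes "\<alpha> \<noteq> 0"
  shows "inj (\<lambda>x. \<alpha> * x ^ (Q + 2) + \<gamma> * x) \<longleftrightarrow> inj (\<lambda>x. x ^ (Q + 2) + \<gamma> / \<alpha> * x)"
proof -
  have "\<alpha> * x ^ (Q + 2) + \<gamma> * x = \<alpha> * (x ^ (Q + 2) + \<gamma> / \<alpha> * x)" for x
    using assms by (simp add: distrib_left)
  then show ?thesis using assms by (simp add: inj_def)
qed

context
  fixes \<alpha> \<gamma> :: 'a
  assumes \<alpha>: "\<alpha> \<noteq> 0" and \<gamma>: "\<gamma> \<in> K"
begin

private lemma quotient_eq: "\<gamma> / \<alpha> = \<alpha> ^ (Q - 1) * (\<gamma> / \<alpha>) ^ Q"
proof -
  have "\<alpha> ^ Q = \<alpha> * \<alpha> ^ (Q - 1)" using Q_gt_1 by (simp flip: power_Suc)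
  then show ?thesis using \<alpha> \<gamma> by (simp add: power_divide frobenius_mem)
qed

text \<open>With \<open>z = \<alpha> ^ (Q - 1)\<close> and
  \<open>D = (\<gamma> / \<alpha>) ^ Q\<close>, the quotient \<open>\<gamma> / \<alpha>\<close>
  equals \<open>z * D\<close>. The expression is homogeneous in \<open>D\<close>, so for nonzero
  \<open>\<gamma>\<close> its vanishing depends on \<open>\<alpha>\<close> alone.\<close>

private lemma discriminant_eq:
  "(\<gamma> / \<alpha> + (\<gamma> / \<alpha>) ^ Q)\<^sup>2 - 3 * (\<gamma> / \<alpha> * (\<gamma> / \<alpha>) ^ Q) =
    ((\<gamma> / \<alpha>) ^ Q)\<^sup>2 * ((\<alpha> ^ (Q - 1))\<^sup>2 - \<alpha> ^ (Q - 1) + 1)"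
proof -
  have "(z * D + D)\<^sup>2 - 3 * (z * D * D) = D\<^sup>2 * (z\<^sup>2 - z + 1)" for z D :: 'a
    by (simp add: algebra_simps power2_eq_square)
  from this[of "\<alpha> ^ (Q - 1)" "(\<gamma> / \<alpha>) ^ Q"] show ?thesis
    by (simp only: quotient_eq[symmetric])
qed

lemma inj_imp_cyclotomic:
  assumes "\<gamma> \<noteq> 0" "inj (\<lambda>x. \<alpha> * x ^ (Q + 2) + \<gamma> * x)"
  shows "(\<alpha> ^ (Q - 1))\<^sup>2 - \<alpha> ^ (Q - 1) + 1 = 0"
proof -
  let ?d = "\<gamma> / \<alpha>"
  have "?d + ?d ^ Q \<in> K" "?d * ?d ^ Q \<in> K"
    using norm_mem[of ?d]
    by (simp_all add: K_eq frobenius_add frobenius_frobenius add.commute)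
  then have "(?d + ?d ^ Q)\<^sup>2 = 3 * (?d * ?d ^ Q)"
    using assms(2) inj_scaled_binomial_iff[OF \<alpha>] inj_binomial_iff[of ?d]
    by (intro cubic_inj_imp_discriminant) blast+
  then show ?thesis using discriminant_eq assms(1) \<alpha> by simp
qed

lemma cyclotomic_imp_inj:
  assumes z: "(\<alpha> ^ (Q - 1))\<^sup>2 - \<alpha> ^ (Q - 1) + 1 = 0" and "Q mod 3 \<noteq> 1"
  shows "inj (\<lambda>x. \<alpha> * x ^ (Q + 2) + \<gamma> * x)"
proof -
  let ?d = "\<gamma> / \<alpha>"
  \<comment> \<open>A nonzero \<open>?d\<close> fixed by Frobenius would give
    \<open>\<alpha> ^ (Q - 1) = 1\<close>, but \<open>1\<close> is not a root of
    \<open>z\<^sup>2 - z + 1\<close>.\<close>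
  have d: "?d = 0" if "?d \<in> K"
  proof (rule ccontr)
    assume "?d \<noteq> 0"
    then have "\<alpha> ^ (Q - 1) = 1"
      using quotient_eq frobenius_mem[OF that] by (metis mult_cancel_right1)
    with z show False by simp
  qed
  have "(?d + ?d ^ Q)\<^sup>2 = 3 * (?d * ?d ^ Q)" using discriminant_eq unfolding z by simp
  then show ?thesis
    using inj_on_cubic[of ?d] assms(2) d inj_scaled_binomial_iff[OF \<alpha>] inj_binomial_iff[of ?d]
    by blast
qed

end

text \<open>The polynomial is the sixth cyclotomic one, and its roots satisfy
  \<open>z ^ 3 = -1\<close>. They have order 6 in general and order 3 in characteristic 2, where
  \<open>-1 = 1\<close>; in characteristic 3 they merge into the double root \<open>-1\<close>. As
  the order divides \<open>Q + 1\<close>, it determines \<open>Q\<close> modulo 6 in the first two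
  cases.\<close>

lemma cyclotomic_iff:
  fixes z :: 'a
  assumes "z ^ (Q + 1) = 1"
  shows "z\<^sup>2 - z + 1 = 0 \<longleftrightarrow>
    ([Q = 5] (mod 6) \<and> mult_order z = 6) \<or>
    ([Q = 2] (mod 6) \<and> mult_order z = 3) \<or>
    ([Q = 0] (mod 3) \<and> z = -1)"
proof -
  have z: "z \<noteq> 0" using assms by auto
  note ord = mult_order_dvd_iff[OF z]
  have two: "2 dvd Q \<longleftrightarrow> (2::'a) = 0" and three: "3 dvd Q \<longleftrightarrow> (3::'a) = 0"
    using prime_dvd_Q_iff[of 2] prime_dvd_Q_iff[of 3] by simp_all
  have neg_one: "(- 1 :: 'a) = 1" if "2 dvd Q"
    using that two by (intro minus_unique) simp
  have cube: "z ^ 3 + 1 = (z + 1) * (z\<^sup>2 - z + 1)"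
    and square: "(z + 1)\<^sup>2 = (z\<^sup>2 - z + 1) + 3 * z"
    by (simp_all add: algebra_simps power2_eq_square power3_eq_cube)
  have Q_cong: "[Q = 5] (mod 6) \<longleftrightarrow> Q mod 6 = 5" "[Q = 2] (mod 6) \<longleftrightarrow> Q mod 6 = 2"
    "[Q = 0] (mod 3) \<longleftrightarrow> 3 dvd Q"
    by (auto simp: cong_def)
  show ?thesis unfolding Q_cong
  proof (intro iffI)
    assume c: "z\<^sup>2 - z + 1 = 0"
    then have z3: "z ^ 3 = -1" using cube by (simp add: eq_neg_iff_add_eq_0)
    then have z6: "z ^ 6 = 1" using power_mult[of z 3 2] by simp
    have dvd: "mult_order z dvd Q + 1" using assms ord by blast
    show "(Q mod 6 = 5 \<and> mult_order z = 6) \<or> (Q mod 6 = 2 \<and> mult_order z = 3) \<or> (3 dvd Q \<and> z = -1)"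
    proof (cases "3 dvd Q")
      case True
      then have "(z + 1)\<^sup>2 = 0" using square c three by simp
      then show ?thesis using True by (simp add: eq_neg_iff_add_eq_0)
    next
      case n3: False
      have z1: "z \<noteq> 1" using c by auto
      have zm1: "z \<noteq> -1" using c n3 three by auto
      have n1: "\<not> mult_order z dvd 1" using ord[of 1] z1 by simp
      show ?thesis
      proof (cases "2 dvd Q")
        case True
        then have "z ^ 3 = 1" using z3 neg_one by simp
        then have "mult_order z dvd 3" using ord by blast
        moreover have "Factorial_Ring.prime (3::nat)" by simp
        ultimately have "mult_order z = 3" using n1 unfolding prime_nat_iff by force
        moreover from this dvd True have "Q mod 6 = 2" by presburger
        ultimately show ?thesis by blast
      next
        case False
        then have "(1::'a) \<noteq> -1" using two by (simp add: eq_neg_iff_add_eq_0)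
        then have n3': "\<not> mult_order z dvd 3" using z3 ord[of 3] by simp
        have n2: "\<not> mult_order z dvd 2"
          using ord[of 2] z1 zm1 by (simp add: power2_eq_1_iff)
        have dvd6: "mult_order z dvd 6" using z6 ord by blast
        then have "mult_order z \<le> 6" "mult_order z > 0"
          by (auto intro: dvd_imp_le dvd_pos_nat[of 6])
        then consider "mult_order z = 1" | "mult_order z = 2" | "mult_order z = 3"
          | "mult_order z = 4" | "mult_order z = 5" | "mult_order z = 6"
          by linarith
        then have "mult_order z = 6" using n1 n2 n3' dvd6 by cases simp_all
        moreover from this dvd n3 have "Q mod 6 = 5" by presburger
        ultimately show ?thesis by blast
      qed
    qed
  next
    assume "(Q mod 6 = 5 \<and> mult_order z = 6) \<or> (Q mod 6 = 2 \<and> mult_order z = 3) \<or> (3 dvd Q \<and> z = -1)"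
    then consider "mult_order z = 6" | "Q mod 6 = 2" "mult_order z = 3" | "3 dvd Q" "z = -1"
      by blast
    then show "z\<^sup>2 - z + 1 = 0"
    proof cases
      case 1
      then have "z ^ 6 = 1" "z ^ 3 \<noteq> 1" "z ^ 2 \<noteq> 1" by (auto simp: ord)
      then have "(z ^ 3)\<^sup>2 = 1" by (simp flip: power_mult)
      then have "z ^ 3 = 1 \<or> z ^ 3 = - 1" by (rule power2_eq_1_iff[THEN iffD1])
      with \<open>z ^ 3 \<noteq> 1\<close> have "z ^ 3 + 1 = 0" by simp
      moreover have "z + 1 \<noteq> 0" using \<open>z ^ 2 \<noteq> 1\<close> by (auto simp flip: eq_neg_iff_add_eq_0)
      ultimately show ?thesis using cube by simp
    next
      case 2
      then have "2 dvd Q" by presburger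
      then have neg: "(- 1 :: 'a) = 1" by (rule neg_one)
      have "z ^ 3 = 1" "z ^ 1 \<noteq> 1" unfolding ord using 2 by simp_all
      then have "z ^ 3 + 1 = 0" "z + 1 \<noteq> 0"
        unfolding eq_neg_iff_add_eq_0[symmetric] neg by simp_all
      then show ?thesis using cube by simp
    next
      case 3
      then show ?thesis using three by simp
    qed
  qed
qed

end

section \<open>Assembling the characterisation\<close>

text \<open>The characteristic divides \<open>Q\<^sup>2\<close>, hence is the prime below
  \<open>Q\<close>. The \<open>Q\<close> elements of \<open>K\<close> all satisfy
  \<open>x ^ Q = x\<close>, which has at most \<open>Q\<close> solutions, so they exhaust
  them.\<close>

lemma quadratic_extensionI:
  fixes K :: "'a::{finite,field} set"
  assumes "primepow Q" and card: "CARD('a) = Q\<^sup>2" and K: "is_subfield K" and cK: "card K = Q"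
  shows "quadratic_extension K Q (multiplicity CHAR('a) Q)"
proof
  have prime: "Factorial_Ring.prime CHAR('a)"
    by (rule prime_CHAR_semidom) (simp add: finite_imp_CHAR_pos)
  obtain p e where p: "Factorial_Ring.prime p" "e > 0" "Q = p ^ e"
    using assms(1) unfolding primepow_def by blast
  have "CHAR('a) dvd Q\<^sup>2" using CHAR_dvd_CARD[where 'a = 'a] by (simp add: card)
  then have "CHAR('a) = p"
    using prime p by (metis prime_dvd_power primes_dvd_imp_eq)
  then show "Q = CHAR('a) ^ multiplicity CHAR('a) Q" "multiplicity CHAR('a) Q > 0"
    using p prime by simp_all
  have sub: "subring K (ring_of_type_algebra :: 'a ring)"
    using K unfolding is_subfield_def by (rule subfieldE(1))
  have "0 \<in> K" "\<And>x y. x \<in> K \<Longrightarrow> y \<in> K \<Longrightarrow> x * y \<in> K"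
    using subringE(2,6)[OF sub] by (simp_all add: ring_of_type_algebra_def)
  then have "K \<subseteq> {x. x ^ Q = x}"
    using power_card_eq_self[of K] cK by auto
  moreover have "card {x::'a. x ^ Q = x} \<le> Q"
    by (rule card_power_fixed_le) (use assms(1) primepow_gt_Suc_0 in auto)
  ultimately show "K = {x. x ^ Q = x}"
    by (intro card_seteq) (simp_all add: cK)
qed (use card cK in auto)

theorem corollary3p4:
  fixes Q :: nat
    and FQ :: "'a::{finite,field} set"
    and \<alpha> \<beta> :: 'a
  assumes "primepow Q"
    and "CARD('a) = Q ^ 2"
    and "is_subfield FQ" and "card FQ = Q"
    and "\<alpha> \<noteq> 0"
    and "\<beta> \<in> FQ"
  shows "complete_permutation_polynomial (Polynomial.monom \<alpha> (Q + 2) + Polynomial.monom \<beta> 1) \<longleftrightarrow>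
    ([Q = 5] (mod 6) \<and> mult_order (\<alpha> ^ (Q - 1)) = 6) \<or>
    ([Q = 2] (mod 6) \<and> mult_order (\<alpha> ^ (Q - 1)) = 3) \<or>
    ([Q = 0] (mod 3) \<and> \<alpha> ^ (Q - 1) = -1)"
proof -
  interpret quadratic_extension FQ Q "multiplicity CHAR('a) Q"
    using assms by (intro quadratic_extensionI)
  let ?z = "\<alpha> ^ (Q - 1)"
  let ?inj = "\<lambda>\<gamma>. inj (\<lambda>x. \<alpha> * x ^ (Q + 2) + \<gamma> * x)"
  let ?f = "Polynomial.monom \<alpha> (Q + 2) + Polynomial.monom \<beta> 1"
  have "poly ?f = (\<lambda>x. \<alpha> * x ^ (Q + 2) + \<beta> * x)"
    "poly (?f + [:0, 1:]) = (\<lambda>x. \<alpha> * x ^ (Q + 2) + (\<beta> + 1) * x)"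
    by (simp_all add: fun_eq_iff poly_monom algebra_simps)
  then have perm: "complete_permutation_polynomial ?f \<longleftrightarrow> ?inj \<beta> \<and> ?inj (\<beta> + 1)"
    by (simp add: complete_permutation_polynomial_def permutation_polynomial_def bij_def
        finite_UNIV_inj_surj conj_ac cong: conj_cong)
  \<comment> \<open>This exponent identity gives \<open>\<alpha> * ?z ^ (Q + 1) = \<alpha>\<close>,
    so \<open>?z\<close> has norm 1.\<close>
  have "(Q - 1) * (Q + 1) + 1 = Q * Q"
    using Q_gt_1 by (simp add: algebra_simps)
  then have "\<alpha> * ?z ^ (Q + 1) = (\<alpha> ^ Q) ^ Q"
    by (simp only: power_mult[symmetric] power_Suc[symmetric] Suc_eq_plus1)
  then have z: "?z ^ (Q + 1) = 1"
    using assms(5) frobenius_frobenius[of \<alpha>] by simp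
  have "complete_permutation_polynomial ?f \<longleftrightarrow> ?z\<^sup>2 - ?z + 1 = 0"
  proof
    assume "complete_permutation_polynomial ?f"
    then have inj: "?inj \<beta>" "?inj (\<beta> + 1)" using perm by auto
    show "?z\<^sup>2 - ?z + 1 = 0"
    proof (cases "\<beta> = 0")
      case True
      then show ?thesis using inj_imp_cyclotomic[of \<alpha> "\<beta> + 1"] inj assms by simp
    next
      case False
      then show ?thesis using inj_imp_cyclotomic[of \<alpha> \<beta>] inj assms by simp
    qed
  next
    assume c: "?z\<^sup>2 - ?z + 1 = 0"
    \<comment> \<open>Existence of a root already excludes \<open>Q mod 3 = 1\<close>, the case in
      which cubing is not injective on the subfield.\<close>
    then have "Q mod 6 = 5 \<or> Q mod 6 = 2 \<or> Q mod 3 = 0"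
      using cyclotomic_iff[OF z] by (auto simp: cong_def)
    then have "Q mod 3 \<noteq> 1" by presburger
    then show "complete_permutation_polynomial ?f"
      unfolding perm using cyclotomic_imp_inj[OF assms(5) _ c] assms(6) by simp
  qed
  also note cyclotomic_iff[OF z]
  finally show ?thesis .
qed

end
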